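(* If $G$ is a connected graph of order $n\geqslant 3$ and $k$ is a natural number, then $D(G^{\frac{1}{2k}})=D''(G^{\frac{1}{k}})$.
   Context: Graphs are finite and simple. The $k$-subdivision $G^{\frac{1}{k}}$ is obtained by replacing each edge $uv$ of $G$ by a path of length $k$ between $u$ and $v$ with $k-1$ new internal vertices. The distinguishing number $D(H)$ is the least $d$ such that some labeling $V(H)\to\{1,\dots,d\}$ is preserved by no non-trivial automorphism of $H$. The total distinguishing number $D''(H)$ is the least $d$ such that there is a labeling $V(H)\cup E(H)\to\{1,\dots,d\}$ (a total colouring, not necessarily proper) preserved only by the identity automorphism of $H$ (an automorphism acts on edges via its action on vertices). *)

theory Defs
  imports "Graph_Theory.Digraph_Component" "Graph_Theory.Pair_Digraph"
begin

text \<open>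
  A finite simple graph is a \<open>pair_graph\<close>: a finite, loop-free, symmetric set of arcs without
  multiplicities. An edge of the graph is the two-element set of the ends of a pair of opposite
  arcs.
\<close>

definition edges :: "'a pair_pre_digraph \<Rightarrow> 'a set set" where
  "edges G = {{u, v} | u v. (u, v) \<in> parcs G}"

definition automorphism :: "'a pair_pre_digraph \<Rightarrow> ('a \<Rightarrow> 'a) \<Rightarrow> bool" where
  "automorphism G f \<longleftrightarrow>
     bij_betw f (pverts G) (pverts G) \<and>
     (\<forall>u \<in> pverts G. \<forall>v \<in> pverts G. (f u, f v) \<in> parcs G \<longleftrightarrow> (u, v) \<in> parcs G)"

text \<open>
  Automorphisms are functions on the whole type, of which only the values on the vertex set matter;
  so being the identity is required on the vertex set only.
\<close>

definition distinguishing :: "'a pair_pre_digraph \<Rightarrow> ('a \<Rightarrow> nat) \<Rightarrow> bool" where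
  "distinguishing G c \<longleftrightarrow>
     (\<forall>f. automorphism G f \<and> (\<forall>v \<in> pverts G. c (f v) = c v) \<longrightarrow> (\<forall>v \<in> pverts G. f v = v))"

definition distinguishing_number :: "'a pair_pre_digraph \<Rightarrow> nat" where
  "distinguishing_number G = (LEAST d. \<exists>c. c \<in> pverts G \<rightarrow> {1..d} \<and> distinguishing G c)"

text \<open>
  A total labeling lives on the disjoint union of the vertex set and the edge set. An automorphism
  maps an edge \<open>e\<close> to its image \<open>f ` e\<close>.
\<close>

definition total_distinguishing :: "'a pair_pre_digraph \<Rightarrow> ('a + 'a set \<Rightarrow> nat) \<Rightarrow> bool" where
  "total_distinguishing G c \<longleftrightarrow>
     (\<forall>f. automorphism G f \<and>
        (\<forall>v \<in> pverts G. c (Inl (f v)) = c (Inl v)) \<and>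
        (\<forall>e \<in> edges G. c (Inr (f ` e)) = c (Inr e))
        \<longrightarrow> (\<forall>v \<in> pverts G. f v = v))"

definition total_distinguishing_number :: "'a pair_pre_digraph \<Rightarrow> nat" where
  "total_distinguishing_number G =
     (LEAST d. \<exists>c. c \<in> (pverts G <+> edges G) \<rightarrow> {1..d} \<and> total_distinguishing G c)"

text \<open>
  In the \<open>k\<close>-subdivision, the internal vertex on the path replacing the edge \<open>uv\<close> that is \<open>i\<close> steps
  away from \<open>u\<close>, and hence \<open>k - i\<close> steps away from \<open>v\<close>, is encoded by the set
  \<open>{(u, i), (v, k - i)}\<close>. This does not depend on the direction in which the edge is traversed.
\<close>

datatype 'a subdiv_vertex = Original 'a | Internal "('a \<times> nat) set"

definition path_vertex :: "nat \<Rightarrow> 'a \<Rightarrow> 'a \<Rightarrow> nat \<Rightarrow> 'a subdiv_vertex" where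
  "path_vertex k u v i =
     (if i = 0 then Original u else if i = k then Original v else Internal {(u, i), (v, k - i)})"

text \<open>
  Only \<open>k \<ge> 1\<close> is meaningful. Each path contributes its arcs in both directions, since
  \<open>parcs G\<close> contains both \<open>(u, v)\<close> and \<open>(v, u)\<close>.
\<close>

definition k_subdivision :: "nat \<Rightarrow> 'a pair_pre_digraph \<Rightarrow> 'a subdiv_vertex pair_pre_digraph" where
  "k_subdivision k G =
     \<lparr> pverts = Original ` pverts G \<union> {path_vertex k u v i | u v i. (u, v) \<in> parcs G \<and> 0 < i \<and> i < k},
       parcs = {(path_vertex k u v i, path_vertex k u v (Suc i)) | u v i. (u, v) \<in> parcs G \<and> i < k} \<rparr>"

lemma path_vertex_rev:
  assumes "k \<ge> 1" "i \<le> k"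
  shows "path_vertex k v u (k - i) = path_vertex k u v i"
  using assms by (auto simp: path_vertex_def)

lemma path_vertex_inner_eq_iff:
  assumes "u \<noteq> v" "0 < i" "i < k" "0 < j" "j < k"
  shows "path_vertex k u v i = path_vertex k x y j \<longleftrightarrow>
           x = u \<and> y = v \<and> j = i \<or> x = v \<and> y = u \<and> j = k - i"
  using assms by (auto simp: path_vertex_def doubleton_eq_iff)

lemma pair_graph_k_subdivision:
  assumes "pair_graph G" "k \<ge> 1"
  shows "pair_graph (k_subdivision k G)"
proof -
  interpret G: pair_graph G by fact
  let ?S = "k_subdivision k G"
  have sym: "(v, u) \<in> parcs G" if "(u, v) \<in> parcs G" for u v
    using that G.pair_sym_arcs by (auto simp: symmetric_def dest: symD)
  have S: "path_vertex k u v i \<in> pverts ?S" if "(u, v) \<in> parcs G" "i \<le> k" for u v i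
  proof (cases "i = 0 \<or> i = k")
    case True
    then show ?thesis
      using that G.in_arcsD1[OF that(1)] G.in_arcsD2[OF that(1)]
      by (auto simp: k_subdivision_def path_vertex_def)
  next
    case False
    then show ?thesis using that by (fastforce simp: k_subdivision_def)
  qed
  have arcs: "parcs ?S = (\<lambda>(e, i). (path_vertex k (fst e) (snd e) i, path_vertex k (fst e) (snd e) (Suc i)))
      ` (parcs G \<times> {..<k})"
    by (force simp: k_subdivision_def)
  have verts: "pverts ?S = Original ` pverts G \<union>
      (\<lambda>(e, i). path_vertex k (fst e) (snd e) i) ` (parcs G \<times> {0<..<k})"
    by (force simp: k_subdivision_def)
  have loopfree: "path_vertex k u v i \<noteq> path_vertex k u v (Suc i)" if "(u, v) \<in> parcs G" "i < k" for u v i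
    using that G.pair_no_loops[of "(u, v)"] by (auto simp: path_vertex_def doubleton_eq_iff)
  have symS: "(y, x) \<in> parcs ?S" if "(x, y) \<in> parcs ?S" for x y
  proof -
    from that obtain u v i where *: "(u, v) \<in> parcs G" "i < k"
        "x = path_vertex k u v i" "y = path_vertex k u v (Suc i)"
      by (auto simp: k_subdivision_def)
    have "y = path_vertex k v u (k - Suc i)" "x = path_vertex k v u (Suc (k - Suc i))"
      using * path_vertex_rev[of k i v u] path_vertex_rev[of k "Suc i" v u] assms(2)
      by (auto simp: Suc_diff_Suc)
    moreover have "k - Suc i < k" using *(2) by simp
    ultimately show ?thesis using sym[OF *(1)] unfolding k_subdivision_def by auto
  qed
  show ?thesis
  proof
    show "fst e \<in> pverts ?S" if "e \<in> parcs ?S" for e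
      using that S by (auto simp: arcs)
    show "snd e \<in> pverts ?S" if "e \<in> parcs ?S" for e
      using that S by (auto simp: arcs)
    show "finite (pverts ?S)"
      unfolding verts using G.pair_finite_verts G.pair_finite_arcs by auto
    show "finite (parcs ?S)"
      unfolding arcs using G.pair_finite_arcs by auto
    show "fst e \<noteq> snd e" if "e \<in> parcs ?S" for e
      using that loopfree by (auto simp: arcs)
    show "symmetric (with_proj ?S)"
      using symS by (auto simp: symmetric_def intro: symI)
  qed
qed

end

theory Submission
  imports Defs
begin

text \<open>
  Subdividing every edge of the \<open>k\<close>-subdivision \<open>H\<close> once more gives the \<open>2k\<close>-subdivision, which is
  therefore the incidence graph of \<open>H\<close>; its vertex labelings are the total labelings of \<open>H\<close>. Every
  automorphism of \<open>H\<close> acts on the incidence graph. Conversely, an automorphism of the incidence graph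
  comes from one of \<open>H\<close> as soon as it maps vertices of \<open>H\<close> to vertices of \<open>H\<close>, and by degrees and
  bipartiteness this can only fail when \<open>H\<close> is 2-regular, that is, a cycle. In that case both numbers
  are 2: a cycle has a nontrivial rotation, so one label is not enough for \<open>H\<close>, and two labels
  suffice for an even cycle of length at least 6.
\<close>

section \<open>Neighbourhoods, automorphisms and connectedness\<close>

definition nbrs :: "'a pair_pre_digraph \<Rightarrow> 'a \<Rightarrow> 'a set" where
  "nbrs G x = {y. (x, y) \<in> parcs G}"

lemma mem_nbrs [simp]: "y \<in> nbrs G x \<longleftrightarrow> (x, y) \<in> parcs G"
  by (simp add: nbrs_def)

context pair_graph
begin

lemma parcs_sym: "(u, v) \<in> parcs G \<Longrightarrow> (v, u) \<in> parcs G"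
  using pair_sym_arcs by (auto simp: symmetric_def dest: symD)

lemma parcs_irrefl: "(u, u) \<notin> parcs G"
  using pair_no_loops by fastforce

lemma parcs_verts: "(u, v) \<in> parcs G \<Longrightarrow> u \<in> pverts G \<and> v \<in> pverts G"
  using in_arcsD1 in_arcsD2 by blast

lemma mem_edges_iff: "{u, v} \<in> edges G \<longleftrightarrow> (u, v) \<in> parcs G"
  using parcs_sym by (auto simp: edges_def doubleton_eq_iff)

lemma edgesE:
  assumes "e \<in> edges G"
  obtains u v where "e = {u, v}" "(u, v) \<in> parcs G" "u \<noteq> v" "u \<in> pverts G" "v \<in> pverts G"
  using assms parcs_verts parcs_irrefl unfolding edges_def by blast

lemma edges_subset: "e \<in> edges G \<Longrightarrow> e \<subseteq> pverts G"
  by (auto elim: edgesE)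

lemma finite_edges: "finite (edges G)"
proof (rule finite_subset)
  show "edges G \<subseteq> Pow (pverts G)" using edges_subset by blast
qed (simp add: pair_finite_verts)

lemma automorphism_edge: "automorphism G f \<Longrightarrow> e \<in> edges G \<Longrightarrow> f ` e \<in> edges G"
  by (auto elim!: edgesE simp: mem_edges_iff automorphism_def)

lemma automorphism_nbrs:
  assumes "automorphism G f" "x \<in> pverts G"
  shows "nbrs G (f x) = f ` nbrs G x"
proof
  show "f ` nbrs G x \<subseteq> nbrs G (f x)"
    using assms parcs_verts by (fastforce simp: automorphism_def)
  show "nbrs G (f x) \<subseteq> f ` nbrs G x"
  proof
    fix y assume y: "y \<in> nbrs G (f x)"
    then have "y \<in> pverts G" using parcs_verts by auto
    then have "y \<in> f ` pverts G" using assms by (simp add: automorphism_def bij_betw_def)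
    then obtain z where "z \<in> pverts G" "y = f z" by blast
    then show "y \<in> f ` nbrs G x" using y assms by (auto simp: automorphism_def)
  qed
qed

lemma automorphism_card_nbrs:
  assumes "automorphism G f" "x \<in> pverts G"
  shows "card (nbrs G (f x)) = card (nbrs G x)"
proof -
  have "nbrs G x \<subseteq> pverts G" using parcs_verts by auto
  then have "inj_on f (nbrs G x)"
    using assms by (meson automorphism_def bij_betw_def inj_on_subset)
  then show ?thesis using automorphism_nbrs[OF assms] by (simp add: card_image)
qed

end

text \<open>Connectedness takes the form of an induction principle: a property that holds at one
  vertex and passes along arcs holds at all vertices. No walks need to be handled later.\<close>

locale connected_pair_graph = pair_graph +
  assumes verts_nonempty: "pverts G \<noteq> {}"
    and arc_closed_set:
      "\<lbrakk>a \<in> A; a \<in> pverts G; \<And>x y. \<lbrakk>(x, y) \<in> parcs G; x \<in> A\<rbrakk> \<Longrightarrow> y \<in> A\<rbrakk> \<Longrightarrow> pverts G \<subseteq> A"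

text \<open>Connectedness is defined by reachability in the symmetric closure. The arcs of
  \<open>G\<close> are already symmetric, so membership in \<open>A\<close> can be followed along
  such a walk.\<close>

lemma connected_pair_graphI:
  assumes "pair_graph G" "connected (with_proj G)"
  shows "connected_pair_graph G"
proof -
  interpret pair_graph G by fact
  show ?thesis
  proof
    show "pverts G \<noteq> {}" using assms(2) by (auto simp: connected_def strongly_connected_def)
    fix a A assume a: "a \<in> A" "a \<in> pverts G"
      and cl: "\<And>x y. \<lbrakk>(x, y) \<in> parcs G; x \<in> A\<rbrakk> \<Longrightarrow> y \<in> A"
    show "pverts G \<subseteq> A"
    proof
      fix y assume "y \<in> pverts G"
      then have "a \<rightarrow>\<^sup>*\<^bsub>mk_symmetric (with_proj G)\<^esub> y"
        using assms(2) a by (auto simp: connected_def strongly_connected_def)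
      then have "(a, y) \<in> (arcs_ends (mk_symmetric (with_proj G)))\<^sup>*"
        by (simp add: reachable_def rtrancl_on_rtranclI)
      then show "y \<in> A"
      proof induction
        case base then show ?case by (rule a)
      next
        case (step y z)
        then have "(y, z) \<in> parcs G"
          using parcs_sym by (auto simp: mk_symmetric_def arcs_ends_def arc_to_ends_def)
        then show ?case using cl step by blast
      qed
    qed
  qed
qed

section \<open>Isomorphism invariance\<close>

text \<open>The graphs to be compared have different vertex types, so an isomorphism takes the place
  of equality.\<close>

definition graph_iso ::
  "'a pair_pre_digraph \<Rightarrow> 'b pair_pre_digraph \<Rightarrow> ('a \<Rightarrow> 'b) \<Rightarrow> bool" where
  "graph_iso G H h \<longleftrightarrow> bij_betw h (pverts G) (pverts H) \<and>
     (\<forall>u \<in> pverts G. \<forall>v \<in> pverts G. (h u, h v) \<in> parcs H \<longleftrightarrow> (u, v) \<in> parcs G)"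

lemma graph_iso_inv:
  assumes "graph_iso G H h"
  shows "graph_iso H G (inv_into (pverts G) h)"
  unfolding graph_iso_def
proof (intro conjI ballI)
  have b: "bij_betw h (pverts G) (pverts H)" using assms by (simp add: graph_iso_def)
  then show "bij_betw (inv_into (pverts G) h) (pverts H) (pverts G)" by (rule bij_betw_inv_into)
  fix x y assume xy: "x \<in> pverts H" "y \<in> pverts H"
  let ?i = "inv_into (pverts G) h"
  have "h (?i x) = x" "h (?i y) = y" "?i x \<in> pverts G" "?i y \<in> pverts G"
    using b xy by (auto simp: bij_betw_def f_inv_into_f inv_into_into)
  then show "((?i x, ?i y) \<in> parcs G) = ((x, y) \<in> parcs H)"
    using assms unfolding graph_iso_def by metis
qed

text \<open>The labeling is pulled back along \<open>h\<close>. A label-preserving automorphism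
  \<open>f\<close> of \<open>G\<close> is conjugated by \<open>h\<close> into one of
  \<open>H\<close>; the latter is trivial, hence so is \<open>f\<close>.\<close>

lemma graph_iso_distinguishing:
  assumes h: "graph_iso G H h" and c: "c \<in> pverts H \<rightarrow> L" "distinguishing H c"
  shows "\<exists>c. c \<in> pverts G \<rightarrow> L \<and> distinguishing G c"
proof (intro exI conjI)
  let ?i = "inv_into (pverts G) h"
  have b: "bij_betw h (pverts G) (pverts H)" using h by (simp add: graph_iso_def)
  have hV: "h x \<in> pverts H" "?i (h x) = x" if "x \<in> pverts G" for x
    using b that by (auto simp: bij_betw_def)
  have iV: "?i y \<in> pverts G" "h (?i y) = y" if "y \<in> pverts H" for y
    using b that by (auto simp: bij_betw_def f_inv_into_f inv_into_into)
  show "c \<circ> h \<in> pverts G \<rightarrow> L" using c hV by auto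
  show "distinguishing G (c \<circ> h)"
    unfolding distinguishing_def
  proof (intro allI impI ballI)
    fix f v assume f: "automorphism G f \<and> (\<forall>v\<in>pverts G. (c \<circ> h) (f v) = (c \<circ> h) v)"
      and v: "v \<in> pverts G"
    have fb: "bij_betw f (pverts G) (pverts G)" using f by (simp add: automorphism_def)
    let ?g = "h \<circ> f \<circ> ?i"
    have fV: "f x \<in> pverts G" if "x \<in> pverts G" for x using fb that by (auto simp: bij_betw_def)
    have "bij_betw ?g (pverts H) (pverts H)"
      using b fb bij_betw_inv_into[OF b] by (meson bij_betw_trans)
    moreover have "(?g x, ?g y) \<in> parcs H \<longleftrightarrow> (x, y) \<in> parcs H"
      if "x \<in> pverts H" "y \<in> pverts H" for x y
    proof -
      have "(?g x, ?g y) \<in> parcs H \<longleftrightarrow> (f (?i x), f (?i y)) \<in> parcs G"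
        using h fV iV that by (auto simp: graph_iso_def)
      also have "\<dots> \<longleftrightarrow> (?i x, ?i y) \<in> parcs G" using f iV that by (auto simp: automorphism_def)
      also have "\<dots> \<longleftrightarrow> (h (?i x), h (?i y)) \<in> parcs H"
        using h iV(1) that unfolding graph_iso_def by blast
      finally show ?thesis using iV that by simp
    qed
    moreover have "c (?g x) = c x" if "x \<in> pverts H" for x
      using f iV that by auto
    ultimately have "automorphism H ?g" "\<forall>x \<in> pverts H. c (?g x) = c x"
      unfolding automorphism_def by auto
    then have "?g (h v) = h v"
      using c(2) hV(1)[OF v] unfolding distinguishing_def by blast
    then have "h (f v) = h v" using hV v by simp
    then show "f v = v" using hV(2) fV v by metis
  qed
qed

lemma distinguishing_number_iso:
  assumes "graph_iso G H h"
  shows "distinguishing_number G = distinguishing_number H"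
proof -
  have "(\<exists>c. c \<in> pverts G \<rightarrow> {1..d} \<and> distinguishing G c) \<longleftrightarrow>
      (\<exists>c. c \<in> pverts H \<rightarrow> {1..d} \<and> distinguishing H c)" for d
    using graph_iso_distinguishing[OF assms] graph_iso_distinguishing[OF graph_iso_inv[OF assms]]
    by blast
  then show ?thesis by (simp only: distinguishing_number_def)
qed

section \<open>Cycles\<close>

text \<open>A finite simple connected 2-regular graph is a cycle. Its vertices are not numbered
  cyclically; the walk \<open>nxt\<close> takes the place of a numbering.\<close>

locale cycle_graph = connected_pair_graph +
  assumes card_nbrs: "v \<in> pverts G \<Longrightarrow> card (nbrs G v) = 2"
begin

lemma nbrsE:
  assumes "(x, y) \<in> parcs G"
  obtains z where "z \<noteq> y" "nbrs G x = {y, z}"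
proof -
  obtain a b where "nbrs G x = {a, b}" "a \<noteq> b"
    using card_nbrs[of x] parcs_verts[OF assms] by (auto simp: card_2_iff)
  moreover have "y \<in> nbrs G x" using assms by simp
  ultimately have "y = a \<or> y = b" by simp
  then show ?thesis using that[of a] that[of b] \<open>nbrs G x = {a, b}\<close> \<open>a \<noteq> b\<close> by auto
qed

text \<open>One step of a walk that never turns back. The state is an arc, so that the direction of
  travel is remembered. On arcs of \<open>G\<close> the description denotes, since each vertex has
  exactly one neighbour besides the one it was entered from.\<close>

definition nxt :: "'a \<times> 'a \<Rightarrow> 'a \<times> 'a" where
  "nxt e = (snd e, THE z. (snd e, z) \<in> parcs G \<and> z \<noteq> fst e)"

lemma nxt_eq: "(x, y) \<in> parcs G \<Longrightarrow> (y, z) \<in> parcs G \<Longrightarrow> z \<noteq> x \<Longrightarrow> nxt (x, y) = (y, z)"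
proof -
  assume a: "(x, y) \<in> parcs G" "(y, z) \<in> parcs G" "z \<noteq> x"
  obtain w where "w \<noteq> x" "nbrs G y = {x, w}" using nbrsE parcs_sym[OF a(1)] by blast
  then have "\<forall>u. (y, u) \<in> parcs G \<longleftrightarrow> u = x \<or> u = w" by (auto simp flip: mem_nbrs)
  then show ?thesis using a by (auto simp: nxt_def intro!: the_equality)
qed

lemma nxtE:
  assumes "(x, y) \<in> parcs G"
  obtains z where "(y, z) \<in> parcs G" "z \<noteq> x" "nxt (x, y) = (y, z)"
proof -
  obtain z where z: "z \<noteq> x" "nbrs G y = {x, z}" using nbrsE parcs_sym[OF assms] by blast
  then have "(y, z) \<in> parcs G" by (auto simp flip: mem_nbrs)
  then show ?thesis using that z nxt_eq[OF assms] by simp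
qed

lemma nxt_arc: "e \<in> parcs G \<Longrightarrow> nxt e \<in> parcs G"
  by (metis nxtE surj_pair)

text \<open>The walk can be run backwards: \<open>(y, z)\<close> can only be preceded by the arc
  into \<open>y\<close> from its neighbour other than \<open>z\<close>.\<close>

lemma nxt_inj: "inj_on nxt (parcs G)"
proof (rule inj_onI)
  fix e e' assume e: "e \<in> parcs G" "e' \<in> parcs G" "nxt e = nxt e'"
  obtain x y x' y' where xy: "e = (x, y)" "e' = (x', y')" by fastforce
  obtain z where z: "(y, z) \<in> parcs G" "z \<noteq> x" "nxt (x, y) = (y, z)" using nxtE e xy by metis
  obtain z' where z': "(y', z') \<in> parcs G" "z' \<noteq> x'" "nxt (x', y') = (y', z')"
    using nxtE e xy by metis
  have eq: "y' = y" "z' = z" using z z' e xy by auto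
  obtain w where w: "w \<noteq> z" "nbrs G y = {z, w}" using nbrsE[OF z(1)] .
  have "x \<in> nbrs G y" "x' \<in> nbrs G y" using e xy eq parcs_sym by auto
  then show "e = e'" using w z z' eq xy by auto
qed

lemma funpow_nxt_arc: "e \<in> parcs G \<Longrightarrow> (nxt ^^ n) e \<in> parcs G"
  by (induction n) (auto intro: nxt_arc)

text \<open>
  A walk that traverses an edge in both directions would have turned around somewhere in between.
\<close>

lemma funpow_nxt_not_reverse: "(x, y) \<in> parcs G \<Longrightarrow> (nxt ^^ n) (x, y) \<noteq> (y, x)"
proof (induction n arbitrary: x y rule: less_induct)
  case (less n)
  obtain z where z: "(y, z) \<in> parcs G" "z \<noteq> x" "nxt (x, y) = (y, z)" using nxtE less.prems by metis
  consider "n = 0" | "n = 1" | m where "n = Suc (Suc m)"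
    by (metis One_nat_def not0_implies_Suc)
  then show ?case
  proof cases
    case 1 then show ?thesis using parcs_irrefl less.prems by auto
  next
    case 2 then show ?thesis using z by auto
  next
    case 3
    show ?thesis
    proof
      assume r: "(nxt ^^ n) (x, y) = (y, x)"
      \<comment> \<open>The second arc of the walk is \<open>(y, z)\<close> and the last but one is
        \<open>(z, y)\<close>. Trimming both ends leaves a reversal in \<open>m\<close>, that is
        \<open>n - 2\<close>, steps.\<close>
      have "nxt (z, y) = (y, x)" using nxt_eq parcs_sym z less.prems by metis
      with r have "nxt ((nxt ^^ Suc m) (x, y)) = nxt (z, y)" using 3 by simp
      then have "(nxt ^^ Suc m) (x, y) = (z, y)"
        using nxt_inj funpow_nxt_arc[OF less.prems] parcs_sym[OF z(1)] by (meson inj_onD)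
      then have "(nxt ^^ m) (y, z) = (z, y)" using z(3) by (simp add: funpow_swap1)
      then show False using less.IH[of m y z] 3 z by simp
    qed
  qed
qed

text \<open>An orbit of \<^const>\<open>nxt\<close> orients the cycle; the automorphism moves every vertex one step along.\<close>

lemma ex_fixpoint_free_automorphism:
  "\<exists>f. automorphism G f \<and> (\<forall>v \<in> pverts G. f v \<noteq> v)"
proof -
  obtain a where a: "a \<in> pverts G" using verts_nonempty by auto
  then have "nbrs G a \<noteq> {}" using card_nbrs by fastforce
  then obtain b where ab: "(a, b) \<in> parcs G" by auto
  \<comment> \<open>\<open>W\<close> will turn out to be one of the two orientations of the
    cycle.\<close>
  define W where "W = range (\<lambda>n. (nxt ^^ n) (a, b))"
  have W_arc: "e \<in> parcs G" if "e \<in> W" for e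
    using that funpow_nxt_arc[OF ab] by (auto simp: W_def)
  have W_nxt: "nxt e \<in> W" if e: "e \<in> W" for e
  proof -
    obtain n where "e = (nxt ^^ n) (a, b)" using e by (auto simp: W_def)
    then have "nxt e = (nxt ^^ Suc n) (a, b)" by simp
    then show ?thesis unfolding W_def by blast
  qed
  have "finite W" using W_arc pair_finite_arcs by (meson finite_subset subsetI)
  moreover have "inj_on nxt W" using nxt_inj W_arc by (meson inj_on_subset subsetI)
  \<comment> \<open>By finiteness an injective map of \<open>W\<close> into itself is onto, so
    \<open>W\<close> is closed under predecessors as well.\<close>
  ultimately have "nxt ` W = W" using W_nxt by (intro endo_inj_surj) auto
  then have W_prev: "e \<in> W" if "nxt e \<in> W" "e \<in> parcs G" for e
    using that nxt_inj W_arc by (metis imageE inj_onD)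
  have no_rev: "(y, x) \<notin> W" if xy: "(x, y) \<in> W" for x y
  proof
    assume "(y, x) \<in> W"
    with xy obtain i j where i: "(x, y) = (nxt ^^ i) (a, b)" and j: "(y, x) = (nxt ^^ j) (a, b)"
      by (auto simp: W_def)
    have arcs: "(x, y) \<in> parcs G" "(y, x) \<in> parcs G" using W_arc xy parcs_sym by auto
    \<comment> \<open>The later of the two visits is reached by walking on from the earlier one, so
      the walk would reverse an edge.\<close>
    show False
    proof (cases "i \<le> j")
      case True
      then have "(nxt ^^ (j - i)) (x, y) = (y, x)"
        unfolding i j by (simp flip: funpow_add comp_apply[of "nxt ^^ (j - i)"])
      then show False using funpow_nxt_not_reverse arcs by blast
    next
      case False
      then have "(nxt ^^ (i - j)) (y, x) = (x, y)"
        unfolding i j by (simp flip: funpow_add comp_apply[of "nxt ^^ (i - j)"])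
      then show False using funpow_nxt_not_reverse arcs by blast
    qed
  qed
  \<comment> \<open>The walk enters \<open>x\<close> from \<open>z\<close> exactly if it goes on to
    \<open>y\<close>. Consequently, two arcs of \<open>W\<close> that both leave or both enter a
    vertex would yield an edge used in both directions, against \<open>no_rev\<close>.\<close>
  have turn: "(z, x) \<in> W \<longleftrightarrow> (x, y) \<in> W"
    if "(x, y) \<in> parcs G" "(x, z) \<in> parcs G" "y \<noteq> z" for x y z
  proof -
    have "nxt (z, x) = (x, y)" using nxt_eq parcs_sym that by metis
    then show ?thesis using W_nxt W_prev parcs_sym that by metis
  qed
  \<comment> \<open>Having an outgoing arc in \<open>W\<close> spreads from \<open>x\<close> to a
    neighbour \<open>y\<close>: if \<open>W\<close> leaves \<open>x\<close> towards
    \<open>y\<close>, the walk goes on from \<open>y\<close>; otherwise it entered \<open>x\<close>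
    from \<open>y\<close>.\<close>
  have "pverts G \<subseteq> {x. \<exists>y. (x, y) \<in> W}"
  proof (rule arc_closed_set)
    have "(a, b) = (nxt ^^ 0) (a, b)" by simp
    then have "(a, b) \<in> W" unfolding W_def by blast
    then show "a \<in> {x. \<exists>y. (x, y) \<in> W}" by auto
    show "a \<in> pverts G" by (rule a)
    fix x y assume xy: "(x, y) \<in> parcs G" "x \<in> {x. \<exists>y. (x, y) \<in> W}"
    then obtain z where z: "(x, z) \<in> W" by auto
    show "y \<in> {x. \<exists>y. (x, y) \<in> W}"
    proof (cases "z = y")
      case True
      obtain w where "nxt (x, y) = (y, w)" using nxtE xy by metis
      then show ?thesis using W_nxt z True by force
    next
      case False
      then show ?thesis using turn[of x z y] z W_arc xy by auto
    qed
  qed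
  then have "\<forall>x \<in> pverts G. \<exists>y. (x, y) \<in> W" by blast
  from bchoice[OF this] obtain f where f: "\<And>x. x \<in> pverts G \<Longrightarrow> (x, f x) \<in> W" by blast
  have f_eq: "f x = y" if "(x, y) \<in> W" for x y
  proof (rule ccontr)
    assume "f x \<noteq> y"
    moreover have "(x, f x) \<in> W" using f W_arc[OF that] parcs_verts by blast
    ultimately show False using turn[of x y "f x"] that W_arc no_rev by blast
  qed
  \<comment> \<open>Every edge is oriented: at \<open>x\<close> it is the outgoing arc or, by
    \<open>turn\<close>, the incoming one.\<close>
  have W_or: "(x, y) \<in> W \<or> (y, x) \<in> W" if "(x, y) \<in> parcs G" for x y
    using turn[of x "f x" y] f that W_arc parcs_verts by metis
  have fV: "f x \<in> pverts G" if "x \<in> pverts G" for x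
    using f[OF that] W_arc parcs_verts by blast
  have inj: "inj_on f (pverts G)"
  proof (rule inj_onI, rule ccontr)
    fix x x' assume x: "x \<in> pverts G" "x' \<in> pverts G" "f x = f x'" "x \<noteq> x'"
    then have "(x, f x) \<in> W" "(x', f x) \<in> W" using f by metis+
    then show False using turn[of "f x" x' x] W_arc parcs_sym no_rev x by blast
  qed
  have "automorphism G f"
    unfolding automorphism_def
  proof (intro conjI ballI)
    show "bij_betw f (pverts G) (pverts G)"
      unfolding bij_betw_def using inj fV by (auto intro!: endo_inj_surj[OF pair_finite_verts])
    have arc: "(f u, f v) \<in> W \<longleftrightarrow> (u, v) \<in> W" if "u \<in> pverts G" "v \<in> pverts G" for u v
    proof
      assume "(u, v) \<in> W"
      then show "(f u, f v) \<in> W" using f_eq f that by metis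
    next
      assume "(f u, f v) \<in> W"
      then have "f (f u) = f v" by (rule f_eq)
      then have "f u = v" using inj fV that by (meson inj_onD)
      then show "(u, v) \<in> W" using f that by metis
    qed
    fix u v assume "u \<in> pverts G" "v \<in> pverts G"
    then show "(f u, f v) \<in> parcs G \<longleftrightarrow> (u, v) \<in> parcs G"
      using arc W_or W_arc parcs_sym by metis
  qed
  moreover have "f v \<noteq> v" if "v \<in> pverts G" for v
    using f W_arc parcs_irrefl that by metis
  ultimately show ?thesis by blast
qed

text \<open>If a vertex and one of its neighbours are fixed, injectivity leaves only one place for
  the other neighbour. The propagated property includes a fixed neighbour so that the argument can
  be repeated.\<close>

lemma automorphism_fixing_arc:
  assumes g: "automorphism G g" and ab: "(a, b) \<in> parcs G" "g a = a" "g b = b"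
    and v: "v \<in> pverts G"
  shows "g v = v"
proof -
  have "pverts G \<subseteq> {x. g x = x \<and> (\<exists>y. (x, y) \<in> parcs G \<and> g y = y)}" (is "_ \<subseteq> ?A")
  proof (rule arc_closed_set)
    show "a \<in> ?A" "a \<in> pverts G" using ab parcs_verts by auto
    fix x z assume xz: "(x, z) \<in> parcs G" "x \<in> ?A"
    then obtain y where y: "(x, y) \<in> parcs G" "g y = y" by auto
    obtain w where w: "w \<noteq> y" "nbrs G x = {y, w}" using nbrsE[OF y(1)] .
    have "(x, w) \<in> parcs G" using w by (auto simp flip: mem_nbrs)
    have "w \<in> pverts G" "y \<in> pverts G" "x \<in> pverts G"
      using \<open>(x, w) \<in> parcs G\<close> y parcs_verts by auto
    then have "g w \<noteq> g y" using w g by (meson automorphism_def bij_betw_def inj_onD)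
    moreover have "g w \<in> nbrs G x"
      using automorphism_nbrs[OF g \<open>x \<in> pverts G\<close>] xz(2) w by auto
    ultimately have "g w = w" using w y by auto
    moreover have "z = y \<or> z = w" using xz w by (auto simp flip: mem_nbrs)
    ultimately show "z \<in> ?A" using y xz parcs_sym by auto
  qed
  then show ?thesis using v by auto
qed

end

section \<open>The incidence graph\<close>

text \<open>The vertex set is the disjoint union on which total labelings of \<open>G\<close> live,
  so vertex labelings here and total labelings of \<open>G\<close> are literally the same
  functions.\<close>

definition incidence_graph :: "'a pair_pre_digraph \<Rightarrow> ('a + 'a set) pair_pre_digraph" where
  "incidence_graph G = \<lparr> pverts = pverts G <+> edges G,
     parcs = {(Inl v, Inr e) | v e. e \<in> edges G \<and> v \<in> e} \<union>
       {(Inr e, Inl v) | v e. e \<in> edges G \<and> v \<in> e} \<rparr>"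

lemma pverts_incidence [simp]: "pverts (incidence_graph G) = pverts G <+> edges G"
  by (simp add: incidence_graph_def)

lemma parcs_incidence [simp]:
  "(Inl v, Inr e) \<in> parcs (incidence_graph G) \<longleftrightarrow> e \<in> edges G \<and> v \<in> e"
  "(Inr e, Inl v) \<in> parcs (incidence_graph G) \<longleftrightarrow> e \<in> edges G \<and> v \<in> e"
  "(Inl v, Inl w) \<notin> parcs (incidence_graph G)"
  "(Inr e, Inr e') \<notin> parcs (incidence_graph G)"
  by (auto simp: incidence_graph_def)

lemma nbrs_incidence_Inr: "e \<in> edges G \<Longrightarrow> nbrs (incidence_graph G) (Inr e) = Inl ` e"
proof (rule set_eqI)
  fix x assume "e \<in> edges G"
  then show "x \<in> nbrs (incidence_graph G) (Inr e) \<longleftrightarrow> x \<in> Inl ` e" by (cases x) auto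
qed

context pair_graph
begin

lemma nbrs_incidence_Inl: "nbrs (incidence_graph G) (Inl v) = (\<lambda>u. Inr {v, u}) ` nbrs G v"
proof (rule set_eqI)
  fix x
  show "x \<in> nbrs (incidence_graph G) (Inl v) \<longleftrightarrow> x \<in> (\<lambda>u. Inr {v, u}) ` nbrs G v"
  proof (cases x)
    case (Inr e)
    have "x \<in> nbrs (incidence_graph G) (Inl v) \<longleftrightarrow> e \<in> edges G \<and> v \<in> e"
      using Inr by simp
    also have "\<dots> \<longleftrightarrow> (\<exists>u. (v, u) \<in> parcs G \<and> e = {v, u})"
    proof
      assume e: "e \<in> edges G \<and> v \<in> e"
      then obtain u w where "e = {u, w}" "(u, w) \<in> parcs G" using edgesE by blast
      then show "\<exists>u. (v, u) \<in> parcs G \<and> e = {v, u}" using e parcs_sym by (auto simp: doubleton_eq_iff)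
    qed (auto simp: mem_edges_iff)
    also have "\<dots> \<longleftrightarrow> x \<in> (\<lambda>u. Inr {v, u}) ` nbrs G v"
      unfolding Inr by (simp add: image_iff Bex_def)
    finally show ?thesis .
  qed auto
qed

lemma card_nbrs_incidence:
  "card (nbrs (incidence_graph G) (Inl v)) = card (nbrs G v)"
  "e \<in> edges G \<Longrightarrow> card (nbrs (incidence_graph G) (Inr e)) = 2"
proof -
  have "inj_on (\<lambda>u. Inr {v, u} :: 'a + 'a set) (nbrs G v)"
    by (auto simp: inj_on_def doubleton_eq_iff)
  then show "card (nbrs (incidence_graph G) (Inl v)) = card (nbrs G v)"
    unfolding nbrs_incidence_Inl by (rule card_image)
  show "e \<in> edges G \<Longrightarrow> card (nbrs (incidence_graph G) (Inr e)) = 2"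
    by (simp add: nbrs_incidence_Inr card_image) (auto elim!: edgesE)
qed

lemma pair_graph_incidence: "pair_graph (incidence_graph G)"
proof -
  have v: "x \<in> pverts (incidence_graph G) \<and> y \<in> pverts (incidence_graph G) \<and> x \<noteq> y
      \<and> (y, x) \<in> parcs (incidence_graph G)"
    if "(x, y) \<in> parcs (incidence_graph G)" for x y
    using that edges_subset by (cases x; cases y) auto
  have finV: "finite (pverts (incidence_graph G))" using finite_edges pair_finite_verts by simp
  show ?thesis
  proof
    fix e assume "e \<in> parcs (incidence_graph G)"
    then show "fst e \<in> pverts (incidence_graph G)" "snd e \<in> pverts (incidence_graph G)" "fst e \<noteq> snd e"
      using v[of "fst e" "snd e"] by auto
  next
    show "finite (pverts (incidence_graph G))" by (rule finV)
    have "parcs (incidence_graph G) \<subseteq> pverts (incidence_graph G) \<times> pverts (incidence_graph G)"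
      using v by (metis SigmaI subrelI)
    then show "finite (parcs (incidence_graph G))"
      using finV by (meson finite_SigmaI finite_subset)
    show "symmetric (with_proj (incidence_graph G))"
      using v by (auto simp: symmetric_def intro!: symI)
  qed
qed

text \<open>An automorphism \<open>f\<close> of \<open>G\<close> acts on the incidence graph by
  \<open>map_sum f (image f)\<close>. Preservation of labels carries over, and \<open>f\<close> is
  trivial if this action is.\<close>

lemma distinguishing_incidence_imp_total:
  assumes "distinguishing (incidence_graph G) c"
  shows "total_distinguishing G c"
  unfolding total_distinguishing_def
proof (intro allI impI ballI)
  fix f v
  assume f: "automorphism G f \<and> (\<forall>v\<in>pverts G. c (Inl (f v)) = c (Inl v)) \<and>
      (\<forall>e\<in>edges G. c (Inr (f ` e)) = c (Inr e))" and v: "v \<in> pverts G"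
  let ?g = "map_sum f (image f)"
  have inj: "inj_on f (pverts G)" and surj: "f ` pverts G = pverts G"
    using f by (auto simp: automorphism_def bij_betw_def)
  have edge: "f ` e \<in> edges G" if "e \<in> edges G" for e
    using that f automorphism_edge by blast
  have inj_e: "inj_on (image f) (edges G)"
    using inj_on_image_eq_iff[OF inj edges_subset edges_subset] by (auto intro: inj_onI)
  have surj_e: "image f ` edges G = edges G"
    using inj_e edge by (intro endo_inj_surj finite_edges) auto
  have "automorphism (incidence_graph G) ?g"
    unfolding automorphism_def
  proof (intro conjI ballI)
    have "inj_on ?g (pverts G <+> edges G)"
    proof (rule inj_onI)
      fix x y assume "x \<in> pverts G <+> edges G" "y \<in> pverts G <+> edges G" "?g x = ?g y"
      then show "x = y"
        by (cases x; cases y) (auto dest: inj_onD[OF inj] inj_onD[OF inj_e])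
    qed
    moreover have "?g ` (pverts G <+> edges G) = pverts G <+> edges G"
      using arg_cong[OF surj, of "image (Inl :: 'a \<Rightarrow> 'a + 'a set)"]
        arg_cong[OF surj_e, of "image (Inr :: 'a set \<Rightarrow> 'a + 'a set)"]
      by (simp add: Plus_def image_Un image_image)
    ultimately show "bij_betw ?g (pverts (incidence_graph G)) (pverts (incidence_graph G))"
      by (simp add: bij_betw_def)
    have mem: "f w \<in> f ` e \<longleftrightarrow> w \<in> e" if "w \<in> pverts G" "e \<in> edges G" for w e
      using inj_on_image_mem_iff[OF inj that(1) edges_subset[OF that(2)]] .
    fix x y assume "x \<in> pverts (incidence_graph G)" "y \<in> pverts (incidence_graph G)"
    then show "(?g x, ?g y) \<in> parcs (incidence_graph G) \<longleftrightarrow> (x, y) \<in> parcs (incidence_graph G)"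
      using mem edge by (cases x; cases y) auto
  qed
  moreover have "\<forall>x \<in> pverts (incidence_graph G). c (?g x) = c x" using f by auto
  ultimately have "?g (Inl v) = Inl v"
    using assms v unfolding distinguishing_def by (metis InlI pverts_incidence)
  then show "f v = v" by simp
qed

text \<open>Under \<open>pres\<close> an automorphism \<open>g\<close> restricts to a vertex map
  \<open>f\<close>, and its values on edges are forced because an edge is determined by its ends. So
  \<open>g\<close> is the action of an automorphism of \<open>G\<close>.\<close>

lemma total_imp_distinguishing_incidence:
  assumes c: "total_distinguishing G c"
    and pres: "\<And>g v. automorphism (incidence_graph G) g \<Longrightarrow> v \<in> pverts G \<Longrightarrow> isl (g (Inl v))"
  shows "distinguishing (incidence_graph G) c"
  unfolding distinguishing_def
proof (intro allI impI)
  fix g assume g: "automorphism (incidence_graph G) g \<and> (\<forall>x \<in> pverts (incidence_graph G). c (g x) = c x)"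
  interpret B: pair_graph "incidence_graph G" by (rule pair_graph_incidence)
  have bij: "bij_betw g (pverts G <+> edges G) (pverts G <+> edges G)"
    using g by (simp add: automorphism_def)
  define f where "f = (\<lambda>v. projl (g (Inl v)))"
  have gl: "g (Inl v) = Inl (f v)" if "v \<in> pverts G" for v
    using pres[of g v] g that by (simp add: f_def)
  have fV: "f v \<in> pverts G" if "v \<in> pverts G" for v
  proof -
    have "g (Inl v) \<in> pverts G <+> edges G" using bij_betwE[OF bij] that by (simp add: InlI)
    then show ?thesis using gl[OF that] by auto
  qed
  have inj: "inj_on f (pverts G)"
  proof (rule inj_onI)
    fix u v assume "u \<in> pverts G" "v \<in> pverts G" "f u = f v"
    then show "u = v" using gl bij unfolding bij_betw_def by (metis InlI inj_onD sum.inject(1))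
  qed
  have surj: "f ` pverts G = pverts G"
    using endo_inj_surj[OF pair_finite_verts] fV inj by auto
  have gr: "g (Inr e) = Inr (f ` e)" "f ` e \<in> edges G" if e: "e \<in> edges G" for e
  proof -
    \<comment> \<open>An edge cannot go to a vertex: as \<open>f\<close> is onto, all vertices are
      already images of vertices.\<close>
    obtain e' where e': "g (Inr e) = Inr e'"
    proof (cases "g (Inr e)")
      case (Inl w)
      then have "w \<in> pverts G" using bij_betwE[OF bij] e by force
      then obtain v where "v \<in> pverts G" "g (Inl v) = g (Inr e)" using surj gl Inl by force
      then show thesis using e bij unfolding bij_betw_def by (metis InlI InrI inj_onD sum.distinct(1))
    qed (use that in auto)
    then have "e' \<in> edges G" using bij_betwE[OF bij] e by force
    \<comment> \<open>The neighbours of an edge are its ends, and \<open>g\<close> carries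
      neighbourhoods to neighbourhoods.\<close>
    then have "Inl ` e' = g ` Inl ` e"
      using B.automorphism_nbrs[of g "Inr e"] g e e' by (simp add: nbrs_incidence_Inr InrI)
    also have "\<dots> = Inl ` f ` e" using gl edges_subset[OF e] by (force simp: image_image)
    finally have "e' = f ` e" by (simp add: inj_image_eq_iff)
    then show "g (Inr e) = Inr (f ` e)" "f ` e \<in> edges G" using e' \<open>e' \<in> edges G\<close> by auto
  qed
  have "automorphism G f"
    unfolding automorphism_def
  proof (intro conjI ballI)
    show "bij_betw f (pverts G) (pverts G)" using inj surj by (simp add: bij_betw_def)
    fix u v assume uv: "u \<in> pverts G" "v \<in> pverts G"
    show "(f u, f v) \<in> parcs G \<longleftrightarrow> (u, v) \<in> parcs G"
    proof
      assume "(u, v) \<in> parcs G"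
      then show "(f u, f v) \<in> parcs G" using gr(2)[of "{u, v}"] by (simp add: mem_edges_iff)
    next
      assume "(f u, f v) \<in> parcs G"
      \<comment> \<open>The edge between the images has a preimage under \<open>g\<close>, which
        must be an edge; injectivity of \<open>f\<close> then identifies it as
        \<open>{u, v}\<close>.\<close>
      then have "Inr {f u, f v} \<in> g ` (pverts G <+> edges G)"
        using bij by (simp add: bij_betw_def mem_edges_iff InrI)
      then obtain e where e: "e \<in> edges G" "f ` e = {f u, f v}" using gl gr by (auto simp: Plus_def)
      then have "f ` e = f ` {u, v}" by simp
      then have "e = {u, v}"
        using inj_on_image_eq_iff[OF inj edges_subset[OF e(1)], of "{u, v}"] uv by simp
      then show "(u, v) \<in> parcs G" using e mem_edges_iff by simp
    qed
  qed
  moreover have "c (Inl (f v)) = c (Inl v)" if "v \<in> pverts G" for v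
    using g gl[OF that] that by (metis InlI pverts_incidence)
  moreover have "c (Inr (f ` e)) = c (Inr e)" if "e \<in> edges G" for e
    using g gr(1)[OF that] that by (metis InrI pverts_incidence)
  ultimately have f: "f v = v" if "v \<in> pverts G" for v
    using c that unfolding total_distinguishing_def by blast
  show "\<forall>x \<in> pverts (incidence_graph G). g x = x"
  proof
    fix x assume x: "x \<in> pverts (incidence_graph G)"
    show "g x = x"
    proof (cases x)
      case (Inr e)
      then have "f ` e = e" using f edges_subset[of e] x by force
      then show ?thesis using gr(1)[of e] x Inr by auto
    qed (use x gl f in auto)
  qed
qed

end

section \<open>Connectedness and the two sides of the incidence graph\<close>

context connected_pair_graph
begin

text \<open>An arc-closed set contains a vertex exactly when it contains an edge at that vertex, so
  the vertices in it form an arc-closed set of \<open>G\<close>.\<close>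

lemma connected_incidence: "connected_pair_graph (incidence_graph G)"
proof -
  interpret B: pair_graph "incidence_graph G" by (rule pair_graph_incidence)
  show ?thesis
  proof
    show "pverts (incidence_graph G) \<noteq> {}" using verts_nonempty by auto
    fix x A assume x: "x \<in> A" "x \<in> pverts (incidence_graph G)"
      and cl: "\<And>x y. \<lbrakk>(x, y) \<in> parcs (incidence_graph G); x \<in> A\<rbrakk> \<Longrightarrow> y \<in> A"
    have inc: "Inl v \<in> A \<longleftrightarrow> Inr e \<in> A" if "e \<in> edges G" "v \<in> e" for v e
      using cl that by (meson parcs_incidence)
    obtain a where a: "a \<in> pverts G" "Inl a \<in> A"
    proof (cases x)
      case (Inr e)
      then have e: "e \<in> edges G" using x by auto
      then obtain u where "u \<in> e" "u \<in> pverts G" by (auto elim: edgesE)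
      then show thesis using that[of u] inc[OF e] x Inr by simp
    qed (use x that in auto)
    have "pverts G \<subseteq> {v. Inl v \<in> A}"
    proof (rule arc_closed_set[OF _ a(1)])
      show "a \<in> {v. Inl v \<in> A}" using a by simp
      fix u v assume "(u, v) \<in> parcs G" "u \<in> {v. Inl v \<in> A}"
      then show "v \<in> {v. Inl v \<in> A}"
        using inc[of "{u, v}" u] inc[of "{u, v}" v] by (auto simp: mem_edges_iff)
    qed
    then have "Inl v \<in> A" if "v \<in> pverts G" for v using that by blast
    moreover have "Inr e \<in> A" if "e \<in> edges G" for e
      using edgesE[OF that] inc[OF that] calculation by (metis insertI1)
    ultimately show "pverts (incidence_graph G) \<subseteq> A" by auto
  qed
qed

text \<open>
  Only \<^term>\<open>Inl\<close> vertices can have degree other than 2. If there is one, then its image is again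
  on the \<^term>\<open>Inl\<close> side, and bipartiteness propagates this to all vertices.
\<close>

lemma incidence_automorphism_isl:
  assumes g: "automorphism (incidence_graph G) g"
    and a: "a \<in> pverts G" "card (nbrs G a) \<noteq> 2" and v: "v \<in> pverts G"
  shows "isl (g (Inl v))"
proof -
  interpret B: connected_pair_graph "incidence_graph G" by (rule connected_incidence)
  have V: "g x \<in> pverts (incidence_graph G)" if "x \<in> pverts (incidence_graph G)" for x
    using g that by (meson automorphism_def bij_betwE)
  have "pverts (incidence_graph G) \<subseteq> {x. isl (g x) \<longleftrightarrow> isl x}"
  proof (rule B.arc_closed_set)
    show "Inl a \<in> pverts (incidence_graph G)" using a by auto
    then have "card (nbrs (incidence_graph G) (g (Inl a))) \<noteq> 2"
      "g (Inl a) \<in> pverts G <+> edges G"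
      using B.automorphism_card_nbrs[OF g] card_nbrs_incidence(1) a V[of "Inl a"] by auto
    then have "isl (g (Inl a))"
      using card_nbrs_incidence(2) by (cases "g (Inl a)") auto
    then show "Inl a \<in> {x. isl (g x) \<longleftrightarrow> isl x}" by simp
    fix x y assume xy: "(x, y) \<in> parcs (incidence_graph G)" "x \<in> {x. isl (g x) \<longleftrightarrow> isl x}"
    have alt: "isl y \<longleftrightarrow> \<not> isl x" if "(x, y) \<in> parcs (incidence_graph G)" for x y
      using that by (cases x; cases y) auto
    have "(g x, g y) \<in> parcs (incidence_graph G)"
      using g xy B.parcs_verts unfolding automorphism_def by blast
    then show "y \<in> {x. isl (g x) \<longleftrightarrow> isl x}" using alt xy by auto
  qed
  then show ?thesis using v by auto
qed

end

section \<open>Cycles and their incidence graphs\<close>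

context cycle_graph
begin

text \<open>Makes the results on cycles, notably \<open>automorphism_fixing_arc\<close>, available
  for the incidence graph.\<close>

lemma incidence_cycle: "cycle_graph (incidence_graph G)"
proof -
  interpret B: connected_pair_graph "incidence_graph G" by (rule connected_incidence)
  show ?thesis
    by standard (auto simp: card_nbrs_incidence card_nbrs)
qed

text \<open>
  Consecutive vertices \<open>x0, x1, x2, x3\<close> of a cycle of length at least 6 are marked, except
  \<open>x2\<close>. The isolated mark \<open>x3\<close> is fixed, and the other two marks cannot be swapped, since
  \<open>x1\<close> but not \<open>x0\<close> is at distance 2 from \<open>x3\<close>.
\<close>

lemma incidence_two_distinguishing:
  "\<exists>c. c \<in> pverts (incidence_graph G) \<rightarrow> {1..2} \<and> distinguishing (incidence_graph G) c"
proof -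
  let ?B = "incidence_graph G"
  interpret B: cycle_graph ?B by (rule incidence_cycle)
  obtain b where b: "b \<in> pverts G" using verts_nonempty by auto
  then obtain a d where ad: "nbrs G b = {a, d}" "a \<noteq> d" using card_nbrs by (meson card_2_iff)
  then have ba: "(b, a) \<in> parcs G" and bd: "(b, d) \<in> parcs G" by (auto simp flip: mem_nbrs)
  have ne: "a \<noteq> b" "d \<noteq> b" using ba bd parcs_irrefl by auto
  have e: "{a, b} \<in> edges G" "{b, d} \<in> edges G"
    using ba bd mem_edges_iff parcs_sym by auto
  have V: "Inl a \<in> pverts ?B" "Inl b \<in> pverts ?B" "Inr {a, b} \<in> pverts ?B" "Inr {b, d} \<in> pverts ?B"
    using ba b e parcs_verts by auto
  \<comment> \<open>Here \<open>x0\<close>, \<open>x1\<close>, \<open>x2\<close>, \<open>x3\<close>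
    are \<open>Inl a\<close>, \<open>Inr {a, b}\<close>, \<open>Inl b\<close>,
    \<open>Inr {b, d}\<close>, with \<open>a\<close> and \<open>d\<close> the two neighbours of
    \<open>b\<close>.\<close>
  define M where "M = {Inl a, Inr {a, b}, Inr {b, d}}"
  define c where "c = (\<lambda>x. if x \<in> M then 2 else 1 :: nat)"
  have "distinguishing ?B c"
    unfolding distinguishing_def
  proof (intro allI impI ballI)
    fix g x assume g: "automorphism ?B g \<and> (\<forall>v \<in> pverts ?B. c (g v) = c v)" and x: "x \<in> pverts ?B"
    have arc: "(g y, g z) \<in> parcs ?B" if "(y, z) \<in> parcs ?B" for y z
      using g that B.parcs_verts unfolding automorphism_def by blast
    have inj: "g y \<noteq> g z" if "y \<noteq> z" "y \<in> pverts ?B" "z \<in> pverts ?B" for y z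
      using g that by (meson automorphism_def bij_betw_def inj_onD)
    have M: "g y \<in> M" if "y \<in> M" for y
    proof -
      have "y \<in> pverts ?B" using that V by (auto simp: M_def)
      then have "c (g y) = c y" using g by blast
      then show ?thesis using that by (simp add: c_def split: if_splits)
    qed
    \<comment> \<open>These are the only two adjacent marks, so \<open>g\<close> fixes both or swaps
      them.\<close>
    have "(g (Inl a), g (Inr {a, b})) \<in> parcs ?B" using arc e by simp
    moreover have "g (Inl a) \<in> M" "g (Inr {a, b}) \<in> M" using M by (auto simp: M_def)
    ultimately have "g (Inl a) = Inl a \<and> g (Inr {a, b}) = Inr {a, b} \<or>
        g (Inl a) = Inr {a, b} \<and> g (Inr {a, b}) = Inl a"
      using ne ad(2) by (auto simp: M_def)
    moreover have False if swap: "g (Inl a) = Inr {a, b}" "g (Inr {a, b}) = Inl a"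
    proof -
      have "{a, b} \<noteq> {b, d}" using ad(2) ne by (auto simp: doubleton_eq_iff)
      then have "g (Inr {b, d}) \<noteq> g (Inl a)" "g (Inr {b, d}) \<noteq> g (Inr {a, b})"
        using inj V by auto
      moreover have "g (Inr {b, d}) \<in> M" using M by (simp add: M_def)
      ultimately have "g (Inr {b, d}) = Inr {b, d}" using swap by (auto simp: M_def)
      \<comment> \<open>\<open>Inl b\<close> is adjacent to \<open>Inr {a, b}\<close> and to
        \<open>Inr {b, d}\<close>. After a swap its image would be adjacent to \<open>Inl a\<close>
        and to \<open>Inr {b, d}\<close>, which lie on opposite sides of a bipartite graph.\<close>
      moreover have "(g (Inl b), g (Inr {a, b})) \<in> parcs ?B" "(g (Inl b), g (Inr {b, d})) \<in> parcs ?B"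
        using arc e by simp_all
      ultimately show False using swap by (cases "g (Inl b)") auto
    qed
    ultimately have "g (Inl a) = Inl a" "g (Inr {a, b}) = Inr {a, b}" by auto
    then show "g x = x"
      using B.automorphism_fixing_arc[of g "Inl a" "Inr {a, b}" x] g x e by auto
  qed
  moreover have "c \<in> pverts ?B \<rightarrow> {1..2}" by (auto simp: c_def)
  ultimately show ?thesis by blast
qed

text \<open>With at most one label the labeling is constant, so the fixpoint-free automorphism
  preserves it.\<close>

lemma total_distinguishing_two_labels:
  assumes c: "c \<in> (pverts G <+> edges G) \<rightarrow> {1..d}" "total_distinguishing G c"
  shows "d \<ge> 2"
proof (rule ccontr)
  assume "\<not> d \<ge> 2"
  \<comment> \<open>This covers \<open>d = 0\<close> as well, where the range \<open>{1..d}\<close>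
    is empty.\<close>
  then have c1: "c x = 1" if "x \<in> pverts G <+> edges G" for x
    using Pi_mem[OF c(1) that] by auto
  obtain f where f: "automorphism G f" "\<forall>v \<in> pverts G. f v \<noteq> v"
    using ex_fixpoint_free_automorphism by blast
  have "f v \<in> pverts G" if "v \<in> pverts G" for v
    using f that by (meson automorphism_def bij_betwE)
  moreover have "f ` e \<in> edges G" if "e \<in> edges G" for e
    using that f automorphism_edge by blast
  ultimately have "\<forall>v\<in>pverts G. c (Inl (f v)) = c (Inl v)" "\<forall>e\<in>edges G. c (Inr (f ` e)) = c (Inr e)"
    using c1 by (auto simp: InlI InrI)
  then have "\<forall>v \<in> pverts G. f v = v" using c(2) f(1) unfolding total_distinguishing_def by blast
  then show False using f(2) verts_nonempty by blast
qed

end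

text \<open>For each single \<open>d\<close>, a labeling of one kind exists exactly when one of the
  other kind does; hence the least such \<open>d\<close> agree.\<close>

theorem (in connected_pair_graph) distinguishing_number_incidence:
  "distinguishing_number (incidence_graph G) = total_distinguishing_number G"
proof -
  have "(\<exists>c. c \<in> pverts (incidence_graph G) \<rightarrow> {1..d} \<and> distinguishing (incidence_graph G) c) \<longleftrightarrow>
      (\<exists>c. c \<in> (pverts G <+> edges G) \<rightarrow> {1..d} \<and> total_distinguishing G c)" (is "?L \<longleftrightarrow> ?R") for d
  proof
    assume ?L
    then show ?R using distinguishing_incidence_imp_total by auto
  next
    assume ?R
    then obtain c where c: "c \<in> (pverts G <+> edges G) \<rightarrow> {1..d}" "total_distinguishing G c" by blast
    show ?L
    proof (cases "\<forall>v \<in> pverts G. card (nbrs G v) = 2")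
      case True
      then interpret cycle_graph G by unfold_locales auto
      \<comment> \<open>On a cycle \<open>c\<close> itself may fail, as it can be preserved by an
        automorphism of the incidence graph that exchanges the two sides. Another labeling replaces
        it, and its two labels are available because \<open>d\<close> is at least 2.\<close>
      have "{1..2} \<subseteq> {1..d}" using total_distinguishing_two_labels[OF c] by auto
      then show ?L using incidence_two_distinguishing by (meson Pi_mono subset_iff)
    next
      case False
      then have "distinguishing (incidence_graph G) c"
        using total_imp_distinguishing_incidence[OF c(2)] incidence_automorphism_isl by blast
      then show ?L using c(1) by auto
    qed
  qed
  then show ?thesis
    by (simp only: distinguishing_number_def total_distinguishing_number_def)
qed

section \<open>Subdivisions\<close>

text \<open>An internal vertex has only two names, one for each direction of traversal. The third
  case is that of the ends, which are shared by the paths of all edges at an original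
  vertex.\<close>

lemma path_vertex_eq_iff:
  assumes "u \<noteq> v" "x \<noteq> y" "i \<le> k" "j \<le> k" "k \<ge> 1"
  shows "path_vertex k u v i = path_vertex k x y j \<longleftrightarrow>
    x = u \<and> y = v \<and> j = i \<or> x = v \<and> y = u \<and> j = k - i \<or>
    i \<in> {0, k} \<and> j \<in> {0, k} \<and> (if i = 0 then u else v) = (if j = 0 then x else y)"
  using assms by (auto simp: path_vertex_def doubleton_eq_iff)

text \<open>An edge of the subdivision lies on a single path, so only the direction of traversal is
  ambiguous. Seen in reverse, the step from \<open>i\<close> to \<open>Suc i\<close> starts at
  \<open>k - Suc i\<close>.\<close>

lemma path_edge_eq_iff:
  assumes "u \<noteq> v" "x \<noteq> y" "i < k" "j < k"
  shows "{path_vertex k u v i, path_vertex k u v (Suc i)} = {path_vertex k x y j, path_vertex k x y (Suc j)} \<longleftrightarrow>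
    x = u \<and> y = v \<and> j = i \<or> x = v \<and> y = u \<and> j = k - Suc i" (is "?L \<longleftrightarrow> ?R")
proof
  assume ?L
  then show ?R
    using assms by (auto simp: doubleton_eq_iff path_vertex_eq_iff)
next
  assume ?R
  then show ?L
  proof
    assume "x = v \<and> y = u \<and> j = k - Suc i"
    moreover have "path_vertex k v u (k - Suc i) = path_vertex k u v (Suc i)"
      "path_vertex k v u (Suc (k - Suc i)) = path_vertex k u v i"
      using path_vertex_rev[of k "Suc i" v u] path_vertex_rev[of k i v u] assms
      by (simp_all add: Suc_diff_Suc)
    ultimately show ?L by (auto simp: insert_commute)
  qed simp
qed

text \<open>Coordinates matching those of \<open>path_vertex (2 * k)\<close>: a path of length
  \<open>k\<close> is traversed in half steps, meeting its vertices and edges alternately.\<close>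

definition half_vertex ::
  "nat \<Rightarrow> 'a \<Rightarrow> 'a \<Rightarrow> nat \<Rightarrow> 'a subdiv_vertex + 'a subdiv_vertex set" where
  "half_vertex k u v i =
     (if even i then Inl (path_vertex k u v (i div 2))
      else Inr {path_vertex k u v (i div 2), path_vertex k u v (Suc (i div 2))})"

text \<open>Equal parities reduce to comparing two vertices or two edges. For different parities
  both sides fail: \<open>i\<close> and \<open>2 * k - i\<close> have the same parity, and the ends
  \<open>0\<close> and \<open>2 * k\<close> are even.\<close>

lemma half_vertex_eq_iff:
  assumes "u \<noteq> v" "x \<noteq> y" "i \<le> 2 * k" "j \<le> 2 * k" "k \<ge> 1"
  shows "half_vertex k u v i = half_vertex k x y j \<longleftrightarrow>
    path_vertex (2 * k) u v i = path_vertex (2 * k) x y j"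
proof -
  have rhs: "path_vertex (2 * k) u v i = path_vertex (2 * k) x y j \<longleftrightarrow>
    x = u \<and> y = v \<and> j = i \<or> x = v \<and> y = u \<and> j = 2 * k - i \<or>
    i \<in> {0, 2 * k} \<and> j \<in> {0, 2 * k} \<and> (if i = 0 then u else v) = (if j = 0 then x else y)"
    using assms by (intro path_vertex_eq_iff) auto
  show ?thesis
  proof (cases "even i"; cases "even j")
    assume "even i" "even j"
    then obtain a b where ij: "i = 2 * a" "j = 2 * b" by (auto elim!: evenE)
    then have "half_vertex k u v i = half_vertex k x y j \<longleftrightarrow> path_vertex k u v a = path_vertex k x y b"
      by (simp add: half_vertex_def)
    also have "\<dots> \<longleftrightarrow> x = u \<and> y = v \<and> b = a \<or> x = v \<and> y = u \<and> b = k - a \<or>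
      a \<in> {0, k} \<and> b \<in> {0, k} \<and> (if a = 0 then u else v) = (if b = 0 then x else y)"
      using assms ij by (intro path_vertex_eq_iff) auto
    moreover have "b = a \<longleftrightarrow> j = i" "b = k - a \<longleftrightarrow> j = 2 * k - i" "a \<in> {0, k} \<longleftrightarrow> i \<in> {0, 2 * k}"
      "b \<in> {0, k} \<longleftrightarrow> j \<in> {0, 2 * k}" "a = 0 \<longleftrightarrow> i = 0" "b = 0 \<longleftrightarrow> j = 0"
      using ij by auto
    ultimately show ?thesis unfolding rhs by (simp only:)
  next
    assume "odd i" "odd j"
    then obtain a b where ij: "i = Suc (2 * a)" "j = Suc (2 * b)" by (auto elim!: oddE)
    then have ab: "a < k" "b < k" using assms by auto
    have "half_vertex k u v i = half_vertex k x y j \<longleftrightarrow>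
      {path_vertex k u v a, path_vertex k u v (Suc a)} = {path_vertex k x y b, path_vertex k x y (Suc b)}"
      using ij by (simp add: half_vertex_def)
    also have "\<dots> \<longleftrightarrow> x = u \<and> y = v \<and> b = a \<or> x = v \<and> y = u \<and> b = k - Suc a"
      using assms ab by (intro path_edge_eq_iff) auto
    moreover have "b = a \<longleftrightarrow> j = i" "b = k - Suc a \<longleftrightarrow> j = 2 * k - i" "i \<noteq> 0" "i \<noteq> 2 * k"
      using ij ab by presburger+
    ultimately show ?thesis unfolding rhs by simp
  next
    assume p: "even i" "odd j"
    then have "j \<noteq> i" "j \<noteq> 2 * k - i" "j \<notin> {0, 2 * k}"
      using assms odd_pos[of j] by auto
    then show ?thesis unfolding rhs using p by (auto simp: half_vertex_def)
  next
    assume p: "odd i" "even j"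
    then have "j \<noteq> i" "j \<noteq> 2 * k - i" "i \<notin> {0, 2 * k}"
      using assms odd_pos[of i] by auto
    then show ?thesis unfolding rhs using p by (auto simp: half_vertex_def)
  qed
qed

text \<open>Both graphs are described by names from \<open>P\<close>. Names coincide in one graph
  exactly when they do in the other, so sending \<open>p s\<close> to \<open>q s\<close> is well
  defined and injective; arcs correspond because the same pairs \<open>R\<close> of names list
  them.\<close>

lemma graph_iso_parametrized:
  assumes V: "pverts G = p ` P" "pverts H = q ` P"
    and eq: "\<And>s t. s \<in> P \<Longrightarrow> t \<in> P \<Longrightarrow> q s = q t \<longleftrightarrow> p s = p t"
    and R: "R \<subseteq> P \<times> P" "parcs G = map_prod p p ` R" "parcs H = map_prod q q ` R"
  shows "\<exists>h. graph_iso G H h"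
proof -
  define h where "h = q \<circ> inv_into P p"
  have h: "h (p s) = q s" if s: "s \<in> P" for s
  proof -
    have "p (inv_into P p (p s)) = p s" "inv_into P p (p s) \<in> P"
      using s by (auto intro: f_inv_into_f inv_into_into)
    then show ?thesis using eq s by (simp add: h_def)
  qed
  have "bij_betw h (pverts G) (pverts H)"
    unfolding bij_betw_def inj_on_def V using h eq by (auto simp: image_image)
  moreover have "(h (p s), h (p t)) \<in> parcs H \<longleftrightarrow> (p s, p t) \<in> parcs G" if st: "s \<in> P" "t \<in> P" for s t
  proof -
    have "(q s, q t) \<in> parcs H \<longleftrightarrow> (\<exists>(s', t') \<in> R. q s = q s' \<and> q t = q t')"
      unfolding R by force
    also have "\<dots> \<longleftrightarrow> (\<exists>(s', t') \<in> R. p s = p s' \<and> p t = p t')"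
      using eq st R(1) by blast
    also have "\<dots> \<longleftrightarrow> (p s, p t) \<in> parcs G" unfolding R by force
    finally show ?thesis using h st by simp
  qed
  ultimately have "graph_iso G H h" unfolding graph_iso_def V by blast
  then show ?thesis by blast
qed

text \<open>Without isolated vertices every original vertex is an end of some path, which lets
  original and internal vertices be named uniformly.\<close>

lemma pverts_k_subdivision:
  assumes "pair_graph G" "k \<ge> 1" and no_isolated: "\<And>v. v \<in> pverts G \<Longrightarrow> \<exists>u. (v, u) \<in> parcs G"
  shows "pverts (k_subdivision k G) = {path_vertex k u v i | u v i. (u, v) \<in> parcs G \<and> i \<le> k}" (is "?V = ?P")
proof
  interpret pair_graph G by fact
  have "Original v \<in> ?P" if v: "v \<in> pverts G" for v
  proof -
    obtain u where "(v, u) \<in> parcs G" using no_isolated[OF v] by blast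
    moreover have "Original v = path_vertex k v u 0" by (simp add: path_vertex_def)
    ultimately show ?thesis by blast
  qed
  then show "?V \<subseteq> ?P" unfolding k_subdivision_def by fastforce
  show "?P \<subseteq> ?V"
  proof
    fix x assume "x \<in> ?P"
    then obtain u v i where x: "x = path_vertex k u v i" "(u, v) \<in> parcs G" "i \<le> k" by blast
    show "x \<in> ?V"
    proof (cases "i = 0 \<or> i = k")
      case True
      then show ?thesis using x parcs_verts[OF x(2)] by (auto simp: k_subdivision_def path_vertex_def)
    next
      case False
      then have "0 < i \<and> i < k" using x by auto
      then show ?thesis using x by (auto simp: k_subdivision_def)
    qed
  qed
qed

lemma edges_k_subdivision:
  "edges (k_subdivision k G) =
    {{path_vertex k u v i, path_vertex k u v (Suc i)} | u v i. (u, v) \<in> parcs G \<and> i < k}"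
  unfolding edges_def k_subdivision_def by auto blast

lemma k_subdivision_iso_incidence:
  assumes G: "pair_graph G" and k: "k \<ge> 1" and no_isolated: "\<And>v. v \<in> pverts G \<Longrightarrow> \<exists>u. (v, u) \<in> parcs G"
  shows "\<exists>h. graph_iso (k_subdivision (2 * k) G) (incidence_graph (k_subdivision k G)) h"
proof -
  interpret pair_graph G by (rule G)
  let ?S = "k_subdivision (2 * k) G" and ?B = "incidence_graph (k_subdivision k G)"
  interpret S: pair_graph ?S using G k by (intro pair_graph_k_subdivision) auto
  define P where "P = {(u, v, i). (u, v) \<in> parcs G \<and> i \<le> 2 * k}"
  \<comment> \<open>Neighbouring positions are listed in both orders, making \<open>R\<close>
    symmetric like the arcs of both graphs.\<close>
  define R where "R = {((u, v, i), (u, v, j)) | u v i j.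
    (u, v) \<in> parcs G \<and> i \<le> 2 * k \<and> j \<le> 2 * k \<and> (j = Suc i \<or> i = Suc j)}"
  define p where "p = (\<lambda>(u :: 'a, v, i). path_vertex (2 * k) u v i)"
  define q where "q = (\<lambda>(u :: 'a, v, i). half_vertex k u v i)"
  have edge: "{path_vertex k u v a, path_vertex k u v (Suc a)} \<in> edges (k_subdivision k G)"
    if "(u, v) \<in> parcs G" "a < k" for u v a
    using that unfolding edges_k_subdivision by blast
  show ?thesis
  proof (rule graph_iso_parametrized)
    have "pverts ?S = {path_vertex (2 * k) u v i | u v i. (u, v) \<in> parcs G \<and> i \<le> 2 * k}"
      using assms by (intro pverts_k_subdivision) auto
    also have "\<dots> = p ` P" by (force simp: p_def P_def)
    finally show "pverts ?S = p ` P" .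
    have VK: "pverts (k_subdivision k G) = {path_vertex k u v i | u v i. (u, v) \<in> parcs G \<and> i \<le> k}"
      using assms by (intro pverts_k_subdivision) auto
    have qP: "half_vertex k u v i \<in> q ` P" if "(u, v) \<in> parcs G" "i \<le> 2 * k" for u v i
    proof (rule image_eqI)
      show "half_vertex k u v i = q (u, v, i)" by (simp add: q_def)
    qed (use that in \<open>simp add: P_def\<close>)
    show "pverts ?B = q ` P"
    proof
      show "pverts ?B \<subseteq> q ` P"
      proof
        fix x assume x: "x \<in> pverts ?B"
        show "x \<in> q ` P"
        proof (cases x)
          case (Inl w)
          then obtain u v a where a: "w = path_vertex k u v a" "(u, v) \<in> parcs G" "a \<le> k"
            using x VK by auto
          then show ?thesis using qP[of u v "2 * a"] Inl by (simp add: half_vertex_def)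
        next
          case (Inr e)
          then obtain u v a where "e = {path_vertex k u v a, path_vertex k u v (Suc a)}"
              "(u, v) \<in> parcs G" "a < k"
            using x by (auto simp: edges_k_subdivision)
          then show ?thesis using qP[of u v "Suc (2 * a)"] Inr by (simp add: half_vertex_def)
        qed
      qed
      show "q ` P \<subseteq> pverts ?B"
      proof
        fix x assume "x \<in> q ` P"
        then obtain u v i where x: "x = half_vertex k u v i" "(u, v) \<in> parcs G" "i \<le> 2 * k"
          by (auto simp: P_def q_def)
        show "x \<in> pverts ?B"
        proof (cases "even i")
          case True
          then have "i div 2 \<le> k" using x by auto
          then have "path_vertex k u v (i div 2) \<in> pverts (k_subdivision k G)"
            using x(2) unfolding VK by blast
          then show ?thesis using x True by (simp add: half_vertex_def InlI)
        next
          case False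
          then have "i div 2 < k" using x by presburger
          then show ?thesis using x edge False by (simp add: half_vertex_def InrI)
        qed
      qed
    qed
    show "q s = q t \<longleftrightarrow> p s = p t" if "s \<in> P" "t \<in> P" for s t
    proof -
      obtain u v i x y j where "s = (u, v, i)" "t = (x, y, j)" by (metis prod_cases3)
      moreover from this have "u \<noteq> v" "x \<noteq> y" "i \<le> 2 * k" "j \<le> 2 * k"
        using that parcs_irrefl by (auto simp: P_def)
      ultimately show ?thesis using half_vertex_eq_iff k by (simp add: p_def q_def)
    qed
    show "R \<subseteq> P \<times> P" by (auto simp: R_def P_def)
    show "parcs ?S = map_prod p p ` R"
    proof
      show "parcs ?S \<subseteq> map_prod p p ` R"
      proof (rule subrelI)
        fix x y assume "(x, y) \<in> parcs ?S"
        then obtain u v i where "x = p (u, v, i)" "y = p (u, v, Suc i)" "(u, v) \<in> parcs G" "i < 2 * k"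
          by (auto simp: k_subdivision_def p_def)
        moreover from this have "((u, v, i), (u, v, Suc i)) \<in> R" by (simp add: R_def)
        ultimately show "(x, y) \<in> map_prod p p ` R" by (metis map_prod_imageI)
      qed
      have up: "(p (u, v, i), p (u, v, Suc i)) \<in> parcs ?S" if "(u, v) \<in> parcs G" "Suc i \<le> 2 * k" for u v i
      proof -
        have "i < 2 * k" using that(2) by simp
        with that(1) show ?thesis by (auto simp: p_def k_subdivision_def)
      qed
      show "map_prod p p ` R \<subseteq> parcs ?S"
        using up S.parcs_sym by (auto simp: R_def)
    qed
    show "parcs ?B = map_prod q q ` R"
    proof
      have flip: "(y, x) \<in> map_prod q q ` R" if "(x, y) \<in> map_prod q q ` R" for x y
      proof -
        from that obtain s t where "x = q s" "y = q t" "(s, t) \<in> R" by auto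
        moreover from this have "(t, s) \<in> R" unfolding R_def by blast
        ultimately show ?thesis by (metis map_prod_imageI)
      qed
      have inc: "(Inl w, Inr e) \<in> map_prod q q ` R" if e: "e \<in> edges (k_subdivision k G)" "w \<in> e" for w e
      proof -
        obtain u v a where a: "e = {path_vertex k u v a, path_vertex k u v (Suc a)}"
            "(u, v) \<in> parcs G" "a < k"
          using e by (auto simp: edges_k_subdivision)
        \<comment> \<open>The edge at the odd position \<open>Suc (2 * a)\<close> has its ends at
          the even positions on either side.\<close>
        have "((u, v, 2 * a), (u, v, Suc (2 * a))) \<in> R"
          "((u, v, Suc (Suc (2 * a))), (u, v, Suc (2 * a))) \<in> R"
          using a by (auto simp: R_def)
        moreover have "q (u, v, Suc (2 * a)) = Inr e" "q (u, v, 2 * a) = Inl (path_vertex k u v a)"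
          "q (u, v, Suc (Suc (2 * a))) = Inl (path_vertex k u v (Suc a))"
          using a by (simp_all add: q_def half_vertex_def)
        moreover have "w = path_vertex k u v a \<or> w = path_vertex k u v (Suc a)" using a e by simp
        ultimately show ?thesis by (metis map_prod_imageI)
      qed
      show "parcs ?B \<subseteq> map_prod q q ` R"
      proof (rule subrelI)
        fix x y assume "(x, y) \<in> parcs ?B"
        then show "(x, y) \<in> map_prod q q ` R" using inc flip by (cases x; cases y) auto
      qed
      have up: "(half_vertex k u v i, half_vertex k u v (Suc i)) \<in> parcs ?B \<and>
          (half_vertex k u v (Suc i), half_vertex k u v i) \<in> parcs ?B"
        if uv: "(u, v) \<in> parcs G" "Suc i \<le> 2 * k" for u v i
      proof -
        \<comment> \<open>Whatever the parity of \<open>i\<close>, one of the half positions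
          \<open>i\<close> and \<open>Suc i\<close> is the edge starting at \<open>i div 2\<close>,
          and the other is one of its ends.\<close>
        have "i div 2 < k" using uv by linarith
        then have "{path_vertex k u v (i div 2), path_vertex k u v (Suc (i div 2))} \<in> edges (k_subdivision k G)"
          using edge uv by blast
        then show ?thesis by (auto simp: half_vertex_def)
      qed
      show "map_prod q q ` R \<subseteq> parcs ?B"
        using up by (auto simp: R_def q_def)
    qed
  qed
qed

section \<open>Connectedness of the subdivision\<close>

lemma (in connected_pair_graph) no_isolated:
  assumes "card (pverts G) \<ge> 2" "v \<in> pverts G"
  shows "\<exists>u. (v, u) \<in> parcs G"
proof (rule ccontr)
  assume "\<nexists>u. (v, u) \<in> parcs G"
  then have "pverts G \<subseteq> {v}" using arc_closed_set[of v "{v}"] assms(2) by auto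
  then have "card (pverts G) \<le> card {v}" by (intro card_mono) auto
  then show False using assms(1) by simp
qed

text \<open>An arc-closed set contains a whole path or nothing of it. Its original vertices are
  therefore closed under adjacency in \<open>G\<close>, and connectedness of \<open>G\<close>
  applies to them.\<close>

lemma connected_k_subdivision:
  assumes G: "connected_pair_graph G" "card (pverts G) \<ge> 2" and k: "k \<ge> 1"
  shows "connected_pair_graph (k_subdivision k G)"
proof -
  interpret connected_pair_graph G by fact
  let ?S = "k_subdivision k G"
  have pg: "pair_graph G" by unfold_locales
  interpret S: pair_graph ?S using pg k by (rule pair_graph_k_subdivision)
  have V: "pverts ?S = {path_vertex k u v i | u v i. (u, v) \<in> parcs G \<and> i \<le> k}"
    using pg k no_isolated[OF G(2)] by (rule pverts_k_subdivision)
  show ?thesis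
  proof
    show "pverts ?S \<noteq> {}" using verts_nonempty by (auto simp: k_subdivision_def)
    fix x A assume x: "x \<in> A" "x \<in> pverts ?S"
      and cl: "\<And>x y. \<lbrakk>(x, y) \<in> parcs ?S; x \<in> A\<rbrakk> \<Longrightarrow> y \<in> A"
    have step: "path_vertex k u v (Suc i) \<in> A \<longleftrightarrow> path_vertex k u v i \<in> A"
      if "(u, v) \<in> parcs G" "i < k" for u v i
    proof -
      have "(path_vertex k u v i, path_vertex k u v (Suc i)) \<in> parcs ?S"
        using that by (auto simp: k_subdivision_def)
      then show ?thesis using cl S.parcs_sym by blast
    qed
    have path: "path_vertex k u v i \<in> A \<longleftrightarrow> Original u \<in> A" if "(u, v) \<in> parcs G" "i \<le> k" for u v i
      using that(2)
    proof (induction i)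
      case (Suc i)
      then show ?case using step[OF that(1), of i] by simp
    qed (simp add: path_vertex_def)
    obtain u v i where "x = path_vertex k u v i" and uv: "(u, v) \<in> parcs G" "i \<le> k"
      using x V by auto
    then have u: "Original u \<in> A" using path x by simp
    have "pverts G \<subseteq> {w. Original w \<in> A}"
    proof (rule arc_closed_set)
      show "u \<in> {w. Original w \<in> A}" "u \<in> pverts G" using u parcs_verts[OF uv(1)] by auto
      fix y z assume yz: "(y, z) \<in> parcs G" "y \<in> {w. Original w \<in> A}"
      have "path_vertex k y z k = Original z" using k by (simp add: path_vertex_def)
      then show "z \<in> {w. Original w \<in> A}" using path[OF yz(1), of k] yz(2) by simp
    qed
    show "pverts ?S \<subseteq> A"
    proof
      fix y assume "y \<in> pverts ?S"
      then obtain u v i where y: "y = path_vertex k u v i" "(u, v) \<in> parcs G" "i \<le> k"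
        unfolding V by blast
      then have "Original u \<in> A" using \<open>pverts G \<subseteq> {w. Original w \<in> A}\<close> parcs_verts by blast
      then show "y \<in> A" using path y by simp
    qed
  qed
qed

theorem theorem3p6:
  fixes G :: "'a pair_pre_digraph" and k :: nat
  assumes "pair_graph G" and "connected (with_proj G)" and "card (pverts G) \<ge> 3" and "k \<ge> 1"
  shows "distinguishing_number (k_subdivision (2 * k) G) =
         total_distinguishing_number (k_subdivision k G)"
proof -
  interpret connected_pair_graph G using assms(1,2) by (rule connected_pair_graphI)
  have card: "card (pverts G) \<ge> 2" using assms(3) by simp
  interpret K: connected_pair_graph "k_subdivision k G"
    using connected_pair_graph_axioms card assms(4) by (rule connected_k_subdivision)
  obtain h where "graph_iso (k_subdivision (2 * k) G) (incidence_graph (k_subdivision k G)) h"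
    using k_subdivision_iso_incidence[OF assms(1,4) no_isolated[OF card]] by blast
  then show ?thesis
    using distinguishing_number_iso K.distinguishing_number_incidence by metis
qed

end
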